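(* Let $1<p\leq 2$ and let $1<p\leq b\leq p'\leq\infty$, where $p'=\frac{p}{p-1}$. If $\varphi=(\varphi(j))_{j\in\mathbb{N}}$ is a positive sequence such that $$M_\varphi:=\sup_{t>0}\, t\sum_{\substack{j\in\mathbb{N}\\ t\leq\varphi(j)}}\|u_j\|_{L^\infty(\mathbb{R}^n)}^2$$ is finite, then for every $f\in L^p(\mathbb{R}^n)$ we have $$\left(\sum_{j\in\mathbb{N}}\left(|\mathcal{F}_{A}f(j)|\,\varphi(j)^{\frac1b-\frac1{p'}}\right)^b\|u_j\|_{L^\infty(\mathbb{R}^n)}^{2-b}\right)^{\frac1b}\lesssim_p M_\varphi^{\frac1b-\frac1{p'}}\|f\|_{L^p(\mathbb{R}^n)}.$$
   Context: Fix integers $n,k,l\geq 1$ and let $A=A_{k,l}=(-\Delta)^l+|x|^{2k}+1$ on $\mathbb{R}^n$ (the anharmonic oscillator), where $\Delta$ is the Laplacian and $|\cdot|$ the Euclidean norm. $A$ has a unique self-adjoint extension on $L^2(\mathbb{R}^n)$ (again denoted $A$), with purely discrete spectrum contained in $(0,\infty)$. Let $(u_j)_{j\in\mathbb{N}}$ be an orthonormal basis of $L^2(\mathbb{R}^n)$ consisting of eigenfunctions of $A$, with corresponding eigenvalues $(\lambda_j)_{j\in\mathbb{N}}$ in increasing order, repeated according to multiplicity. The $A$-Fourier transform of $f$ is $\mathcal{F}_Af(j)=\int_{\mathbb{R}^n}f(x)\overline{u_j(x)}\,dx$, $j\in\mathbb{N}$. The notation $X\lesssim_p Y$ means $X\leq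 CY$ with a constant $C>0$ that may depend on $p$ (and on the fixed data) but not on $f$ or $\varphi$. *)

theory Defs
  imports "HOL-Analysis.Analysis" "HOL-Probability.Essential_Supremum"
begin

section \<open>Lebesgue spaces on \<open>real ^ 'n\<close>\<close>

text \<open>
  Elements of Lebesgue spaces are represented by Lebesgue measurable complex functions; nothing is
  quotiented by almost-everywhere equality.
\<close>

definition Lp_space :: "real \<Rightarrow> ('a::euclidean_space \<Rightarrow> complex) set" where
  "Lp_space p = {f \<in> borel_measurable lebesgue. integrable lebesgue (\<lambda>x. norm (f x) powr p)}"

definition Lp_norm :: "real \<Rightarrow> ('a::euclidean_space \<Rightarrow> complex) \<Rightarrow> real" where
  "Lp_norm p f = (LINT x|lebesgue. norm (f x) powr p) powr (1 / p)"

definition Linf_norm :: "('a::euclidean_space \<Rightarrow> complex) \<Rightarrow> ennreal" where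
  "Linf_norm f = esssup lebesgue (\<lambda>x. ennreal (norm (f x)))"

definition L2_inner :: "('a::euclidean_space \<Rightarrow> complex) \<Rightarrow> ('a \<Rightarrow> complex) \<Rightarrow> complex" where
  "L2_inner f g = (LINT x|lebesgue. f x * cnj (g x))"

definition orthonormal_basis :: "(nat \<Rightarrow> 'a::euclidean_space \<Rightarrow> complex) \<Rightarrow> bool" where
  "orthonormal_basis u \<longleftrightarrow>
     (\<forall>j. u j \<in> Lp_space 2) \<and>
     (\<forall>i j. L2_inner (u i) (u j) = (if i = j then 1 else 0)) \<and>
     (\<forall>f \<in> Lp_space 2. \<forall>\<epsilon>>0. \<exists>N c. Lp_norm 2 (\<lambda>x. f x - (\<Sum>j<N. c j * u j x)) < \<epsilon>)"


section \<open>Unbounded operators on \<open>L\<^sup>2\<close>\<close>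

text \<open>
  An operator is given by its graph, a set of pairs of representatives. A graph equal to its
  adjoint is automatically a linear subspace, closed under changing representatives, and, when the
  domain is dense, single-valued up to almost-everywhere equality.
\<close>

type_synonym 'a operator = "(('a \<Rightarrow> complex) \<times> ('a \<Rightarrow> complex)) set"

definition densely_defined :: "'a::euclidean_space operator \<Rightarrow> bool" where
  "densely_defined T \<longleftrightarrow>
     (\<forall>v \<in> Lp_space 2. \<forall>\<epsilon>>0. \<exists>f \<in> Domain T. f \<in> Lp_space 2 \<and> Lp_norm 2 (\<lambda>x. v x - f x) < \<epsilon>)"

definition adjoint_operator :: "'a::euclidean_space operator \<Rightarrow> 'a operator" where
  "adjoint_operator T = {(v, w). v \<in> Lp_space 2 \<and> w \<in> Lp_space 2 \<and>
     (\<forall>(f, g) \<in> T. L2_inner g v = L2_inner f w)}"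

definition self_adjoint :: "'a::euclidean_space operator \<Rightarrow> bool" where
  "self_adjoint T \<longleftrightarrow> densely_defined T \<and> adjoint_operator T = T"

definition eigenfunction :: "'a::euclidean_space operator \<Rightarrow> real \<Rightarrow> ('a \<Rightarrow> complex) \<Rightarrow> bool" where
  "eigenfunction T \<mu> v \<longleftrightarrow>
     (v, \<lambda>x. of_real \<mu> * v x) \<in> T \<and> \<not> (AE x in lebesgue. v x = 0)"


section \<open>The anharmonic oscillator\<close>

definition partial_deriv :: "'n \<Rightarrow> (real ^ 'n \<Rightarrow> complex) \<Rightarrow> real ^ 'n::finite \<Rightarrow> complex" where
  "partial_deriv i f x = frechet_derivative f (at x) (axis i 1)"

text \<open>
  Smoothness: every iterated partial derivative (including the function itself, for the empty list
  of directions) is differentiable everywhere.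
\<close>

definition smooth :: "(real ^ 'n::finite \<Rightarrow> complex) \<Rightarrow> bool" where
  "smooth f \<longleftrightarrow> (\<forall>is. \<forall>x. fold partial_deriv is f differentiable (at x))"

definition test_functions :: "(real ^ 'n::finite \<Rightarrow> complex) set" where
  "test_functions = {f. smooth f \<and> compact (closure {x. f x \<noteq> 0})}"

definition laplacian :: "(real ^ 'n::finite \<Rightarrow> complex) \<Rightarrow> real ^ 'n \<Rightarrow> complex" where
  "laplacian f x = (\<Sum>i\<in>UNIV. partial_deriv i (partial_deriv i f) x)"

definition anharmonic_expr ::
    "nat \<Rightarrow> nat \<Rightarrow> (real ^ 'n::finite \<Rightarrow> complex) \<Rightarrow> real ^ 'n \<Rightarrow> complex" where
  "anharmonic_expr k l f x =
     ((\<lambda>g y. - laplacian g y) ^^ l) f x + of_real (norm x ^ (2 * k)) * f x + f x"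

definition anharmonic_minimal :: "nat \<Rightarrow> nat \<Rightarrow> (real ^ 'n::finite) operator" where
  "anharmonic_minimal k l = {(f, anharmonic_expr k l f) | f. f \<in> test_functions}"

text \<open>
  \<open>anharmonic_minimal k l\<close> is essentially self-adjoint, so exactly one \<open>T\<close> satisfies the following
  predicate.
\<close>

definition is_anharmonic_oscillator :: "nat \<Rightarrow> nat \<Rightarrow> (real ^ 'n::finite) operator \<Rightarrow> bool" where
  "is_anharmonic_oscillator k l T \<longleftrightarrow> self_adjoint T \<and> anharmonic_minimal k l \<subseteq> T"


section \<open>The Fourier transform of an orthonormal basis\<close>

definition fourier_coeff ::
    "(nat \<Rightarrow> 'a::euclidean_space \<Rightarrow> complex) \<Rightarrow> ('a \<Rightarrow> complex) \<Rightarrow> nat \<Rightarrow> complex" where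
  "fourier_coeff u f j = (LINT x|lebesgue. f x * cnj (u j x))"

definition M_bound ::
    "(nat \<Rightarrow> 'a::euclidean_space \<Rightarrow> complex) \<Rightarrow> (nat \<Rightarrow> real) \<Rightarrow> ennreal" where
  "M_bound u \<phi> = (SUP t\<in>{0<..}. ennreal t * (\<Sum>\<^sub>\<infinity>j\<in>{j. t \<le> \<phi> j}. (Linf_norm (u j))\<^sup>2))"

end

theory Submission imports Defs begin

text \<open>
  Write \<open>m j\<close> for the supremum norm of \<open>u j\<close>, \<open>F j\<close> for the \<open>j\<close>-th coefficient of \<open>f\<close>, and
  \<open>X j = \<bar>F j\<bar> / m j\<close>. Giving the index \<open>j\<close> the mass \<open>(m j)\<^sup>2\<close>, the sum to be bounded is
  \<open>\<Sum>j. X j powr b * \<phi> j powr (1 - b / p') * (m j)\<^sup>2\<close>. Finiteness of \<open>M_bound u \<phi>\<close> already makes every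
  \<open>m j\<close> finite, and the whole estimate comes from two facts about the coefficients: Bessel's inequality,
  and \<open>\<bar>F j\<bar> \<le> m j * \<parallel>f\<parallel>\<^sub>1\<close>.

  The endpoint \<open>b = p\<close> is Paley's inequality, proved by Marcinkiewicz interpolation
  (\<open>paley_below_two\<close>). Give \<open>j\<close> the mass \<open>(\<phi> j * m j)\<^sup>2\<close> and consider the map sending \<open>f\<close> to
  the sequence \<open>X j / \<phi> j\<close>. By Bessel it is bounded from \<open>L\<^sup>2\<close> to \<open>\<ell>\<^sup>2\<close>; it is of weak
  type \<open>(1, 1)\<close> because \<open>X j / \<phi> j > s\<close> forces \<open>\<phi> j < \<parallel>f\<parallel>\<^sub>1 / s\<close>, and the indices with small \<open>\<phi> j\<close>
  have small total mass (\<open>sum_squares_below_le\<close>). Cutting \<open>f\<close> at a height proportional to \<open>s\<close>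
  bounds the mass of \<open>{j. X j / \<phi> j \<ge> s}\<close> (\<open>level_set_le\<close>), and integrating over \<open>s\<close> gives the inequality.
  Taking the factor of proportionality equal to the bound \<open>B\<close> on the weight function yields the
  power \<open>B powr (2 - p)\<close>.

  The endpoint \<open>b = p'\<close> is a weighted Hausdorff--Young inequality, and it follows from Paley's
  inequality by choosing the weight \<open>\<phi> j = X j powr p'\<close>: Chebyshev's inequality bounds its weight
  constant by the very sum \<open>S\<close> that is to be estimated, so Paley reads
  \<open>S \<le> K * S powr (2 - p) * \<parallel>f\<parallel>\<^sub>p powr p\<close>, and one divides by \<open>S powr (2 - p)\<close>
  (\<open>hausdorff_young_finite\<close>).

  Intermediate \<open>b\<close> follow from the endpoints by Hoelder's inequality. All estimates are made over
  finite sets of indices, uniformly, which gives convergence of the series, and makes the division by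
  \<open>S powr (2 - p)\<close> legitimate.
\<close>


section \<open>Integrals of powers and inequalities for finite sums\<close>

lemma borel_measurable_cnj [measurable]: "cnj \<in> borel_measurable borel"
  by (intro borel_measurable_continuous_onI continuous_intros)

lemma nn_integral_powr_below:
  fixes a c :: real
  assumes "a > -1" "c \<ge> 0"
  shows "(\<integral>\<^sup>+t. ennreal (t powr a * indicator {0..c} t) \<partial>lborel) = ennreal (c powr (a + 1) / (a + 1))"
  using nn_integral_has_integral_lebesgue'[OF _ has_integral_powr_from_0[OF assms]]
  by (simp add: ennreal_mult' flip: ennreal_indicator)

lemma nn_integral_powr_above:
  fixes a c :: real
  assumes "a < -1" "c > 0"
  shows "(\<integral>\<^sup>+t. ennreal (t powr a * indicator {c..} t) \<partial>lborel) = ennreal (- (c powr (a + 1)) / (a + 1))"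
  using nn_integral_has_integral_lebesgue'[OF _ has_integral_powr_to_inf[OF assms]]
  by (simp add: ennreal_mult' flip: ennreal_indicator)

text \<open>
  Bounds \<open>A\<close> and \<open>C\<close> on the two sums are given separately, so that the estimates at the two
  endpoints can be inserted directly; after normalising by them, Young's inequality holds term by term.
\<close>

lemma holder_sum_le:
  fixes a c :: "'i \<Rightarrow> real"
  assumes "finite J" and nonneg: "\<And>j. j \<in> J \<Longrightarrow> a j \<ge> 0" "\<And>j. j \<in> J \<Longrightarrow> c j \<ge> 0"
    and A: "(\<Sum>j\<in>J. a j) \<le> A" and C: "(\<Sum>j\<in>J. c j) \<le> C" and s: "0 \<le> s" "s \<le> 1"
  shows "(\<Sum>j\<in>J. a j powr (1 - s) * c j powr s) \<le> A powr (1 - s) * C powr s"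
proof (cases "\<forall>j\<in>J. a j = 0 \<or> c j = 0")
  case True
  then have "(\<Sum>j\<in>J. a j powr (1 - s) * c j powr s) = 0" by (intro sum.neutral) auto
  then show ?thesis by simp
next
  case False
  then obtain i where i: "i \<in> J" "a i > 0" "c i > 0" using nonneg by force
  have "a i \<le> (\<Sum>j\<in>J. a j)" "c i \<le> (\<Sum>j\<in>J. c j)"
    using i nonneg \<open>finite J\<close> by (auto intro: member_le_sum)
  with i A C have pos: "A > 0" "C > 0" by linarith+
  have "(\<Sum>j\<in>J. a j powr (1 - s) * c j powr s)
      \<le> (\<Sum>j\<in>J. A powr (1 - s) * C powr s * ((1 - s) * (a j / A) + s * (c j / C)))"
  proof (rule sum_mono)
    fix j assume j: "j \<in> J"
    show "a j powr (1 - s) * c j powr s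
        \<le> A powr (1 - s) * C powr s * ((1 - s) * (a j / A) + s * (c j / C))"
    proof (cases "a j = 0 \<or> c j = 0")
      case True
      then show ?thesis using nonneg[OF j] pos s by auto
    next
      case False
      then have "(a j / A) powr (1 - s) * (c j / C) powr s \<le> (1 - s) * (a j / A) + s * (c j / C)"
        using nonneg[OF j] pos s by (intro Youngs_inequality_0) auto
      then show ?thesis
        using nonneg[OF j] pos by (simp add: powr_divide divide_simps mult_ac)
    qed
  qed
  also have "\<dots> = A powr (1 - s) * C powr s * ((1 - s) * ((\<Sum>j\<in>J. a j) / A) + s * ((\<Sum>j\<in>J. c j) / C))"
    by (simp add: sum_distrib_left[symmetric] sum.distrib sum_divide_distrib[symmetric])
  also have "\<dots> \<le> A powr (1 - s) * C powr s * ((1 - s) * 1 + s * 1)"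
    using A C pos s by (intro mult_left_mono add_mono) auto
  finally show ?thesis by simp
qed

text \<open>
  With \<open>(\<phi> j)\<^sup>2\<close> written as the integral of \<open>2 * t\<close> over \<open>0 \<le> t \<le> \<phi> j\<close>, the hypothesis bounds
  the integrand by \<open>2 * B\<close> at every height \<open>t \<le> s\<close>. This is where the weight condition turns into a
  weak-type estimate.
\<close>

lemma sum_squares_below_le:
  fixes \<phi> w :: "'i \<Rightarrow> real"
  assumes "finite J" and \<phi>: "\<And>j. j \<in> J \<Longrightarrow> \<phi> j > 0"
    and w: "\<And>j. j \<in> J \<Longrightarrow> w j \<ge> 0"
    and B: "\<And>t. t > 0 \<Longrightarrow> t * (\<Sum>j\<in>{j\<in>J. t \<le> \<phi> j}. w j) \<le> B" and "B \<ge> 0" "s \<ge> 0"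
  shows "(\<Sum>j\<in>{j\<in>J. \<phi> j \<le> s}. (\<phi> j)\<^sup>2 * w j) \<le> 2 * s * B"
proof -
  let ?K = "{j\<in>J. \<phi> j \<le> s}"
  have "((\<lambda>t. \<Sum>j\<in>?K. (if t \<in> {0..\<phi> j} then 2 * t else 0) * w j) has_integral
      (\<Sum>j\<in>?K. (\<phi> j)\<^sup>2 * w j)) {0..s}"
  proof (intro has_integral_sum has_integral_mult_left)
    fix j assume j: "j \<in> ?K"
    have "((\<lambda>t. 2 * t) has_integral (2 * (((\<phi> j)\<^sup>2 - 0\<^sup>2) / 2))) {0..\<phi> j}"
      using \<phi>[of j] j by (intro has_integral_mult_right ident_has_integral) auto
    then show "((\<lambda>t. if t \<in> {0..\<phi> j} then 2 * t else 0) has_integral (\<phi> j)\<^sup>2) {0..s}"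
      using j by (subst has_integral_restrict) auto
  qed (use \<open>finite J\<close> in auto)
  moreover have "((\<lambda>t. 2 * B) has_integral (s - 0) *\<^sub>R (2 * B)) {0..s}"
    using has_integral_const_real[of "2 * B" 0 s] \<open>s \<ge> 0\<close> by simp
  moreover have "(\<Sum>j\<in>?K. (if t \<in> {0..\<phi> j} then 2 * t else 0) * w j) \<le> 2 * B"
    if t: "t \<in> {0..s}" for t
  proof (cases "t = 0")
    case False
    with t have "t > 0" by auto
    have "(\<Sum>j\<in>?K. (if t \<in> {0..\<phi> j} then 2 * t else 0) * w j)
        = (\<Sum>j\<in>{j\<in>?K. t \<le> \<phi> j}. 2 * (t * w j))"
      using \<open>t > 0\<close> \<open>finite J\<close> by (intro sum.mono_neutral_cong_right) auto
    also have "\<dots> \<le> 2 * (t * (\<Sum>j\<in>{j\<in>J. t \<le> \<phi> j}. w j))"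
      unfolding sum_distrib_left using \<open>finite J\<close> \<open>t > 0\<close> w by (intro sum_mono2) auto
    also have "\<dots> \<le> 2 * B" using B[OF \<open>t > 0\<close>] by simp
    finally show ?thesis .
  next
    case True
    then have "(\<Sum>j\<in>?K. (if t \<in> {0..\<phi> j} then 2 * t else 0) * w j) = 0"
      by (intro sum.neutral) auto
    then show ?thesis using \<open>B \<ge> 0\<close> by simp
  qed
  ultimately have "(\<Sum>j\<in>?K. (\<phi> j)\<^sup>2 * w j) \<le> (s - 0) *\<^sub>R (2 * B)"
    by (rule has_integral_le)
  then show ?thesis by (simp add: mult_ac)
qed


section \<open>Square integrability and truncation\<close>

lemma integrable_product_of_square_integrable:
  fixes f g :: "'a \<Rightarrow> complex" and Q :: "'a measure"
  assumes [measurable]: "f \<in> borel_measurable Q" "g \<in> borel_measurable Q"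
    and "integrable Q (\<lambda>x. (norm (f x))\<^sup>2)" "integrable Q (\<lambda>x. (norm (g x))\<^sup>2)"
  shows "integrable Q (\<lambda>x. f x * cnj (g x))"
proof (rule Bochner_Integration.integrable_bound)
  show "integrable Q (\<lambda>x. (norm (f x))\<^sup>2 + (norm (g x))\<^sup>2)" using assms by simp
  have "a * b \<le> a\<^sup>2 + b\<^sup>2" if "a \<ge> 0" "b \<ge> 0" for a b :: real
    using sum_squares_bound[of a b] that mult_nonneg_nonneg[OF that] by linarith
  then show "AE x in Q. norm (f x * cnj (g x)) \<le> norm ((norm (f x))\<^sup>2 + (norm (g x))\<^sup>2)"
    by (auto simp: norm_mult)
qed measurable

text \<open>
  Above the height \<open>c\<close> a large power dominates a small one, and below it the reverse holds, so the
  tall part of an \<open>L\<^sup>p\<close> function lies in \<open>L\<^sup>1\<close> and the flat part in \<open>L\<^sup>2\<close>.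
\<close>

lemma truncation_integrable:
  fixes f :: "'a \<Rightarrow> complex" and Q :: "'a measure"
  assumes f [measurable]: "f \<in> borel_measurable Q"
    and fp: "integrable Q (\<lambda>x. norm (f x) powr p)" and p: "1 \<le> p" "p \<le> 2" and "c > 0"
  shows "integrable Q (\<lambda>x. if c < norm (f x) then f x else 0)" (is "integrable Q ?f1")
    and "integrable Q (\<lambda>x. (norm (if c < norm (f x) then 0 else f x))\<^sup>2)" (is "integrable Q ?f2")
proof -
  show "integrable Q ?f1"
  proof (rule Bochner_Integration.integrable_bound)
    show "integrable Q (\<lambda>x. c powr (1 - p) * norm (f x) powr p)" using fp by simp
    have "r \<le> c powr (1 - p) * r powr p" if "c < r" for r
    proof -
      have "r = r powr (1 - p) * r powr p" using that \<open>c > 0\<close> by (simp flip: powr_add)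
      also have "\<dots> \<le> c powr (1 - p) * r powr p"
        using that \<open>c > 0\<close> p by (intro mult_right_mono powr_mono2') auto
      finally show ?thesis .
    qed
    then show "AE x in Q. norm (?f1 x) \<le> norm (c powr (1 - p) * norm (f x) powr p)" by auto
  qed measurable
  show "integrable Q ?f2"
  proof (rule Bochner_Integration.integrable_bound)
    show "integrable Q (\<lambda>x. c powr (2 - p) * norm (f x) powr p)" using fp by simp
    have "r\<^sup>2 \<le> c powr (2 - p) * r powr p" if "r \<le> c" "r \<ge> 0" for r
    proof (cases "r = 0")
      case False
      then have "r\<^sup>2 = r powr (2 - p) * r powr p" using that by (simp flip: powr_add)
      also have "\<dots> \<le> c powr (2 - p) * r powr p"
        using that p by (intro mult_right_mono powr_mono2) auto
      finally show ?thesis .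
    qed auto
    then show "AE x in Q. norm (?f2 x) \<le> norm (c powr (2 - p) * norm (f x) powr p)" by auto
  qed measurable
qed


section \<open>Bounded orthonormal systems\<close>

text \<open>
  Here \<open>m j\<close> may be any upper bound for the supremum norm of \<open>u j\<close>. Sigma-finiteness is what
  lets the integration over the heights be interchanged with the one over \<open>Q\<close>.
\<close>

locale bounded_orthonormal_system = sigma_finite_measure Q for Q :: "'a measure" +
  fixes u :: "'i \<Rightarrow> 'a \<Rightarrow> complex" and m :: "'i \<Rightarrow> real"
  assumes u_measurable [measurable]: "\<And>j. u j \<in> borel_measurable Q"
    and u_square_integrable: "\<And>j. integrable Q (\<lambda>x. (norm (u j x))\<^sup>2)"
    and orthonormal: "\<And>i j. (LINT x|Q. u i x * cnj (u j x)) = (if i = j then 1 else 0)"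
    and u_bound: "\<And>j. AE x in Q. norm (u j x) \<le> m j"
    and m_pos: "\<And>j. m j > 0"
begin

definition coeff :: "('a \<Rightarrow> complex) \<Rightarrow> 'i \<Rightarrow> complex" where
  "coeff f j = (LINT x|Q. f x * cnj (u j x))"

lemma bessel:
  assumes f [measurable]: "f \<in> borel_measurable Q" and f2: "integrable Q (\<lambda>x. (norm (f x))\<^sup>2)"
    and "finite J"
  shows "(\<Sum>j\<in>J. (norm (coeff f j))\<^sup>2) \<le> (LINT x|Q. (norm (f x))\<^sup>2)"
proof -
  define c where "c = coeff f"
  define g where "g = (\<lambda>x. \<Sum>j\<in>J. c j * u j x)"
  have int_fu: "integrable Q (\<lambda>x. f x * cnj (u j x))" for j
    using integrable_product_of_square_integrable[OF f u_measurable f2 u_square_integrable] .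
  have int_uu: "integrable Q (\<lambda>x. u i x * cnj (u j x))" for i j
    using integrable_product_of_square_integrable[OF u_measurable u_measurable
        u_square_integrable u_square_integrable] .
  have int_ff: "integrable Q (\<lambda>x. f x * cnj (f x))"
    using integrable_product_of_square_integrable[OF f f f2 f2] .
  have int_uf: "integrable Q (\<lambda>x. u j x * cnj (f x))" for j
    using integrable_product_of_square_integrable[OF u_measurable f u_square_integrable f2] .
  have uf: "(LINT x|Q. u j x * cnj (f x)) = cnj (c j)" for j
    unfolding c_def coeff_def using Bochner_Integration.integral_cnj[of Q "\<lambda>x. f x * cnj (u j x)"]
    by (simp add: mult.commute)
  have expand: "(f x - g x) * cnj (f x - g x) = f x * cnj (f x)
      - (\<Sum>j\<in>J. cnj (c j) * (f x * cnj (u j x))) - (\<Sum>j\<in>J. c j * (u j x * cnj (f x)))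
      + (\<Sum>i\<in>J. \<Sum>j\<in>J. c i * cnj (c j) * (u i x * cnj (u j x)))" for x
  proof -
    have "g x * cnj (g x) = (\<Sum>i\<in>J. \<Sum>j\<in>J. c i * cnj (c j) * (u i x * cnj (u j x)))"
      unfolding g_def cnj_sum sum_product by (simp add: mult_ac)
    moreover have "f x * cnj (g x) = (\<Sum>j\<in>J. cnj (c j) * (f x * cnj (u j x)))"
      unfolding g_def cnj_sum sum_distrib_left by (simp add: mult_ac)
    moreover have "g x * cnj (f x) = (\<Sum>j\<in>J. c j * (u j x * cnj (f x)))"
      unfolding g_def sum_distrib_right by (simp add: mult_ac)
    ultimately show ?thesis by (simp add: algebra_simps)
  qed
  have "(LINT x|Q. (f x - g x) * cnj (f x - g x)) = (LINT x|Q. f x * cnj (f x))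
      - (\<Sum>j\<in>J. cnj (c j) * c j) - (\<Sum>j\<in>J. c j * cnj (c j))
      + (\<Sum>i\<in>J. \<Sum>j\<in>J. c i * cnj (c j) * (if i = j then 1 else 0))"
    unfolding expand
    by (simp add: int_fu int_uu int_ff int_uf uf orthonormal del: mult_if_delta)
       (simp add: c_def coeff_def)
  also have "\<dots> = (LINT x|Q. f x * cnj (f x)) - (\<Sum>j\<in>J. c j * cnj (c j))"
    using \<open>finite J\<close> by (simp add: if_distrib mult.commute sum.delta cong: if_cong)
  finally have "complex_of_real (LINT x|Q. (norm (f x - g x))\<^sup>2)
      = complex_of_real ((LINT x|Q. (norm (f x))\<^sup>2) - (\<Sum>j\<in>J. (norm (c j))\<^sup>2))"
    by (simp only: of_real_diff of_real_sum complex_norm_square integral_complex_of_real[symmetric])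
  then have "(LINT x|Q. (norm (f x - g x))\<^sup>2) = (LINT x|Q. (norm (f x))\<^sup>2) - (\<Sum>j\<in>J. (norm (c j))\<^sup>2)"
    using of_real_eq_iff by blast
  moreover have "(LINT x|Q. (norm (f x - g x))\<^sup>2) \<ge> 0" by simp
  ultimately show ?thesis by (simp add: c_def)
qed

lemma norm_coeff_le_L1:
  assumes "integrable Q f"
  shows "integrable Q (\<lambda>x. f x * cnj (u j x))" "norm (coeff f j) \<le> m j * (LINT x|Q. norm (f x))"
proof -
  have bd: "AE x in Q. norm (f x * cnj (u j x)) \<le> m j * norm (f x)"
    using u_bound[of j] by eventually_elim (simp add: norm_mult mult.commute[of "norm (f _)"] mult_right_mono)
  have int: "integrable Q (\<lambda>x. m j * norm (f x))" using assms by simp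
  have [measurable]: "f \<in> borel_measurable Q" using assms by simp
  show I: "integrable Q (\<lambda>x. f x * cnj (u j x))"
    by (rule Bochner_Integration.integrable_bound[OF int])
       (use bd in \<open>auto elim!: eventually_mono\<close>)
  have "norm (coeff f j) \<le> (LINT x|Q. norm (f x * cnj (u j x)))"
    unfolding coeff_def by (rule integral_norm_bound)
  also have "\<dots> \<le> (LINT x|Q. m j * norm (f x))"
    by (rule integral_mono_AE) (use I int bd in auto)
  finally show "norm (coeff f j) \<le> m j * (LINT x|Q. norm (f x))" by simp
qed


section \<open>Paley's inequality\<close>

text \<open>
  If \<open>X j / \<phi> j \<ge> s\<close>, then the coefficient of the tall part or that of the flat part of \<open>f\<close> reaches
  half the height. In the first case \<open>\<phi> j\<close> is at most \<open>2 / s\<close> times the \<open>L\<^sup>1\<close> norm of the tall part,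
  which confines \<open>j\<close> to a set controlled by \<open>sum_squares_below_le\<close>; in the second case Chebyshev's
  inequality and Bessel's inequality apply.
\<close>

lemma level_set_le:
  assumes f [measurable]: "f \<in> borel_measurable Q"
    and fp: "integrable Q (\<lambda>x. norm (f x) powr p)" and p: "1 \<le> p" "p \<le> 2"
    and J: "finite J" and \<phi>: "\<And>j. j \<in> J \<Longrightarrow> \<phi> j > 0"
    and B: "\<And>t. t > 0 \<Longrightarrow> t * (\<Sum>j\<in>{j\<in>J. t \<le> \<phi> j}. (m j)\<^sup>2) \<le> B" and "B > 0" "s > 0"
  shows "(\<Sum>j\<in>{j\<in>J. s \<le> norm (coeff f j) / (\<phi> j * m j)}. (\<phi> j * m j)\<^sup>2)
    \<le> 4 * B / s * (LINT x|Q. norm (if B * s < norm (f x) then f x else 0))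
      + 4 / s\<^sup>2 * (LINT x|Q. (norm (if B * s < norm (f x) then 0 else f x))\<^sup>2)"
proof -
  define f1 where "f1 = (\<lambda>x. if B * s < norm (f x) then f x else 0)"
  define f2 where "f2 = (\<lambda>x. if B * s < norm (f x) then 0 else f x)"
  have meas [measurable]: "f1 \<in> borel_measurable Q" "f2 \<in> borel_measurable Q"
    unfolding f1_def f2_def by measurable
  have "B * s > 0" using \<open>B > 0\<close> \<open>s > 0\<close> by simp
  note tr = truncation_integrable[OF f fp p this, folded f1_def]
  have f1: "integrable Q f1" and f2: "integrable Q (\<lambda>x. (norm (f2 x))\<^sup>2)"
    using tr unfolding f2_def by auto
  define I1 where "I1 = (LINT x|Q. norm (f1 x))"
  define I2 where "I2 = (LINT x|Q. (norm (f2 x))\<^sup>2)"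
  have I: "I1 \<ge> 0" "I2 \<ge> 0" unfolding I1_def I2_def by simp_all
  have split: "coeff f j = coeff f1 j + coeff f2 j" for j
  proof -
    have "coeff f j = (LINT x|Q. f1 x * cnj (u j x) + f2 x * cnj (u j x))"
      unfolding coeff_def by (intro Bochner_Integration.integral_cong) (auto simp: f1_def f2_def)
    also have "\<dots> = coeff f1 j + coeff f2 j"
      unfolding coeff_def using norm_coeff_le_L1(1)[OF f1]
        integrable_product_of_square_integrable[OF meas(2) u_measurable f2 u_square_integrable]
      by (rule Bochner_Integration.integral_add)
    finally show ?thesis .
  qed
  let ?A = "{j\<in>J. \<phi> j \<le> 2 * I1 / s}"
  let ?D = "{j\<in>J. s / 2 \<le> norm (coeff f2 j) / (\<phi> j * m j)}"
  have sub: "{j\<in>J. s \<le> norm (coeff f j) / (\<phi> j * m j)} \<subseteq> ?A \<union> ?D"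
  proof
    fix j assume "j \<in> {j\<in>J. s \<le> norm (coeff f j) / (\<phi> j * m j)}"
    then have j: "j \<in> J" and s: "s * (\<phi> j * m j) \<le> norm (coeff f j)"
      using \<phi>[of j] m_pos[of j] by (auto simp: field_simps)
    have le: "norm (coeff f j) \<le> m j * I1 + norm (coeff f2 j)"
      unfolding split I1_def
      using norm_triangle_ineq[of "coeff f1 j" "coeff f2 j"] norm_coeff_le_L1(2)[OF f1, of j]
      by linarith
    show "j \<in> ?A \<union> ?D"
    proof (cases "\<phi> j \<le> 2 * I1 / s")
      case False
      then have "2 * I1 < s * \<phi> j" using \<open>s > 0\<close> by (simp add: field_simps)
      then have "2 * (m j * I1) \<le> s * (\<phi> j * m j)"
        using mult_left_mono[of "2 * I1" "s * \<phi> j" "m j"] m_pos[of j] by (simp add: mult_ac)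
      with le s have "s / 2 * (\<phi> j * m j) \<le> norm (coeff f2 j)" by linarith
      then show ?thesis using j \<phi>[of j] m_pos[of j] by (simp add: field_simps)
    qed (use j in auto)
  qed
  have A: "(\<Sum>j\<in>?A. (\<phi> j * m j)\<^sup>2) \<le> 4 * B / s * I1"
    using sum_squares_below_le[of J \<phi> "\<lambda>j. (m j)\<^sup>2" B "2 * I1 / s"] J \<phi> B \<open>B > 0\<close> \<open>s > 0\<close> I
    by (simp add: power_mult_distrib mult_ac)
  have D: "(\<Sum>j\<in>?D. (\<phi> j * m j)\<^sup>2) \<le> 4 / s\<^sup>2 * I2"
  proof -
    have "(\<Sum>j\<in>?D. (\<phi> j * m j)\<^sup>2) \<le> (\<Sum>j\<in>?D. 4 / s\<^sup>2 * (norm (coeff f2 j))\<^sup>2)"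
    proof (rule sum_mono)
      fix j assume "j \<in> ?D"
      then have "\<phi> j * m j \<le> 2 / s * norm (coeff f2 j)" "0 \<le> \<phi> j * m j"
        using \<phi>[of j] m_pos[of j] \<open>s > 0\<close> by (auto simp: field_simps)
      then have "(\<phi> j * m j)\<^sup>2 \<le> (2 / s * norm (coeff f2 j))\<^sup>2" by (rule power_mono)
      then show "(\<phi> j * m j)\<^sup>2 \<le> 4 / s\<^sup>2 * (norm (coeff f2 j))\<^sup>2"
        by (simp add: power_mult_distrib power_divide)
    qed
    also have "\<dots> \<le> 4 / s\<^sup>2 * I2"
      unfolding sum_distrib_left[symmetric] I2_def using J \<open>s > 0\<close>
      by (intro mult_left_mono bessel f2 meas) auto
    finally show ?thesis .
  qed
  have "(\<Sum>j\<in>{j\<in>J. s \<le> norm (coeff f j) / (\<phi> j * m j)}. (\<phi> j * m j)\<^sup>2)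
      \<le> (\<Sum>j\<in>?A \<union> ?D. (\<phi> j * m j)\<^sup>2)"
    using sub J by (intro sum_mono2) auto
  also have "\<dots> \<le> (\<Sum>j\<in>?A. (\<phi> j * m j)\<^sup>2) + (\<Sum>j\<in>?D. (\<phi> j * m j)\<^sup>2)"
    using J by (subst sum_Un) (auto intro!: sum_nonneg)
  finally show ?thesis using A D unfolding I1_def I2_def f1_def f2_def by linarith
qed

text \<open>
  Layer-cake integration of \<open>level_set_le\<close> against \<open>p * s powr (p - 1)\<close>. After Fubini, the tall
  part contributes at \<open>x\<close> the integral of \<open>s powr (p - 2)\<close> up to \<open>\<bar>f x\<bar> / B\<close>, which converges at \<open>0\<close>
  because \<open>p > 1\<close>, and the flat part that of \<open>s powr (p - 3)\<close> beyond \<open>\<bar>f x\<bar> / B\<close>, which converges at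
  infinity because \<open>p < 2\<close>. Both are multiples of \<open>B powr (2 - p) * \<bar>f x\<bar> powr p\<close>.
\<close>

lemma paley_below_two:
  assumes f [measurable]: "f \<in> borel_measurable Q"
    and fp: "integrable Q (\<lambda>x. norm (f x) powr p)" and p: "1 < p" "p < 2"
    and J: "finite J" and \<phi>: "\<And>j. j \<in> J \<Longrightarrow> \<phi> j > 0"
    and B: "\<And>t. t > 0 \<Longrightarrow> t * (\<Sum>j\<in>{j\<in>J. t \<le> \<phi> j}. (m j)\<^sup>2) \<le> B" and "B > 0"
  shows "(\<Sum>j\<in>J. (norm (coeff f j) / m j) powr p * \<phi> j powr (2 - p) * (m j)\<^sup>2)
    \<le> (4 * p / (p - 1) + 4 * p / (2 - p)) * B powr (2 - p) * (LINT x|Q. norm (f x) powr p)"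
proof -
  define T where "T j = norm (coeff f j) / (\<phi> j * m j)" for j
  define \<nu> where "\<nu> j = (\<phi> j * m j)\<^sup>2" for j
  define K where "K = (4 * p / (p - 1) + 4 * p / (2 - p)) * B powr (2 - p)"
  \<comment> \<open>Integrand of the bound in \<open>level_set_le\<close>, times \<open>p * s powr (p - 1)\<close>; the truncations become
      conditions on \<open>s\<close>.\<close>
  define G where "G s x =
      (if 0 \<le> s \<and> s \<le> norm (f x) / B then 4 * p * B * norm (f x) * s powr (p - 2) else 0)
    + (if norm (f x) / B \<le> s then 4 * p * (norm (f x))\<^sup>2 * s powr (p - 3) else 0)" for s x
  have G_nonneg: "G s x \<ge> 0" for s x unfolding G_def using p \<open>B > 0\<close> by auto
  have T_nonneg: "T j \<ge> 0" if "j \<in> J" for j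
    unfolding T_def using \<phi>[OF that] m_pos[of j] by simp
  \<comment> \<open>The substitution that turns Paley's sum into the \<open>p\<close>-th moment of \<open>T\<close> for the masses \<open>\<nu>\<close>.\<close>
  have summand: "(norm (coeff f j) / m j) powr p * \<phi> j powr (2 - p) * (m j)\<^sup>2 = \<nu> j * T j powr p"
    if "j \<in> J" for j
  proof -
    have "\<phi> j powr (2 - p) = (\<phi> j)\<^sup>2 / \<phi> j powr p" using \<phi>[OF that] by (simp add: powr_diff)
    moreover have "T j powr p = (norm (coeff f j) / m j) powr p / \<phi> j powr p"
      unfolding T_def using \<phi>[OF that] m_pos[of j]
      by (subst powr_divide[symmetric]) (auto simp: field_simps)
    ultimately show ?thesis unfolding \<nu>_def by (simp add: power_mult_distrib)
  qed
  have layer: "ennreal (\<nu> j * T j powr p)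
      = (\<integral>\<^sup>+s. ennreal (p * \<nu> j * (s powr (p - 1) * indicator {0..T j} s)) \<partial>lborel)" if "j \<in> J" for j
  proof -
    have "(\<integral>\<^sup>+s. ennreal (p * \<nu> j * (s powr (p - 1) * indicator {0..T j} s)) \<partial>lborel)
        = ennreal (p * \<nu> j) * (\<integral>\<^sup>+s. ennreal (s powr (p - 1) * indicator {0..T j} s) \<partial>lborel)"
      using p by (subst ennreal_mult', simp add: \<nu>_def, subst nn_integral_cmult) auto
    also have "\<dots> = ennreal (\<nu> j * T j powr p)"
      using p T_nonneg[OF that]
      by (subst nn_integral_powr_below) (auto simp: \<nu>_def ennreal_mult'[symmetric])
    finally show ?thesis by simp
  qed
  have level: "(\<Sum>j\<in>J. ennreal (p * \<nu> j * (s powr (p - 1) * indicator {0..T j} s)))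
      \<le> (\<integral>\<^sup>+x. ennreal (G s x) \<partial>Q)" for s
  proof (cases "s > 0")
    case True
    define f1 where "f1 = (\<lambda>x. if B * s < norm (f x) then f x else 0)"
    define f2 where "f2 = (\<lambda>x. if B * s < norm (f x) then 0 else f x)"
    have "B * s > 0" using \<open>B > 0\<close> \<open>s > 0\<close> by simp
    then have f1: "integrable Q f1" and f2: "integrable Q (\<lambda>x. (norm (f2 x))\<^sup>2)"
      using truncation_integrable[OF f fp, of "B * s"] p unfolding f1_def f2_def by auto
    have "(\<Sum>j\<in>J. ennreal (p * \<nu> j * (s powr (p - 1) * indicator {0..T j} s)))
        = ennreal (\<Sum>j\<in>J. p * \<nu> j * (s powr (p - 1) * indicator {0..T j} s))"
      using p by (intro sum_ennreal) (simp add: \<nu>_def)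
    also have "(\<Sum>j\<in>J. p * \<nu> j * (s powr (p - 1) * indicator {0..T j} s))
        = p * s powr (p - 1) * (\<Sum>j\<in>{j\<in>J. s \<le> T j}. \<nu> j)"
      unfolding sum_distrib_left using \<open>s > 0\<close> J by (intro sum.mono_neutral_cong_right) auto
    also have "ennreal \<dots> \<le> ennreal (p * s powr (p - 1) *
        (4 * B / s * (LINT x|Q. norm (f1 x)) + 4 / s\<^sup>2 * (LINT x|Q. (norm (f2 x))\<^sup>2)))"
      unfolding \<nu>_def T_def f1_def f2_def
      using p by (intro ennreal_leI mult_left_mono level_set_le[OF f fp _ _ J \<phi> B \<open>B > 0\<close> \<open>s > 0\<close>]) auto
    also have "p * s powr (p - 1) *
        (4 * B / s * (LINT x|Q. norm (f1 x)) + 4 / s\<^sup>2 * (LINT x|Q. (norm (f2 x))\<^sup>2))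
      = (LINT x|Q. p * s powr (p - 1) * (4 * B / s * norm (f1 x) + 4 / s\<^sup>2 * (norm (f2 x))\<^sup>2))"
      using f1 f2 by simp
    also have "ennreal \<dots> = (\<integral>\<^sup>+x. ennreal (p * s powr (p - 1) *
        (4 * B / s * norm (f1 x) + 4 / s\<^sup>2 * (norm (f2 x))\<^sup>2)) \<partial>Q)"
      using f1 f2 p \<open>B > 0\<close> \<open>s > 0\<close> by (intro nn_integral_eq_integral[symmetric]) auto
    also have "\<dots> \<le> (\<integral>\<^sup>+x. ennreal (G s x) \<partial>Q)"
    proof (intro nn_integral_mono ennreal_leI)
      fix x
      have e: "s powr (p - 2) = s powr (p - 1) / s" "s powr (p - 3) = s powr (p - 1) / s\<^sup>2"
        using \<open>s > 0\<close> powr_diff[of s "p - 1" 1] powr_diff[of s "p - 1" 2] by simp_all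
      show "p * s powr (p - 1) * (4 * B / s * norm (f1 x) + 4 / s\<^sup>2 * (norm (f2 x))\<^sup>2) \<le> G s x"
        unfolding G_def f1_def f2_def e using \<open>s > 0\<close> \<open>B > 0\<close> p
        by (auto simp: field_simps)
    qed
    finally show ?thesis .
  next
    case False
    then have "(\<Sum>j\<in>J. ennreal (p * \<nu> j * (s powr (p - 1) * indicator {0..T j} s))) = 0"
      by (intro sum.neutral) (auto simp: indicator_def)
    then show ?thesis by simp
  qed
  have inner: "(\<integral>\<^sup>+s. ennreal (G s x) \<partial>lborel) = ennreal (K * norm (f x) powr p)" for x
  proof (cases "f x = 0")
    case False
    define r where "r = norm (f x)"
    have r: "r > 0" "r / B > 0" using False \<open>B > 0\<close> by (auto simp: r_def)
    have "(\<integral>\<^sup>+s. ennreal (G s x) \<partial>lborel)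
        = (\<integral>\<^sup>+s. ennreal (4 * p * B * r) * ennreal (s powr (p - 2) * indicator {0..r / B} s)
            + ennreal (4 * p * r\<^sup>2) * ennreal (s powr (p - 3) * indicator {r / B..} s) \<partial>lborel)"
      using p r \<open>B > 0\<close> unfolding G_def r_def[symmetric]
      by (intro nn_integral_cong)
         (auto simp: indicator_def ennreal_mult'[symmetric] ennreal_plus[symmetric] simp del: ennreal_plus)
    also have "\<dots> = ennreal (4 * p * B * r) * ennreal ((r / B) powr (p - 2 + 1) / (p - 2 + 1))
        + ennreal (4 * p * r\<^sup>2) * ennreal (- ((r / B) powr (p - 3 + 1)) / (p - 3 + 1))"
      using p r by (simp add: nn_integral_add nn_integral_cmult nn_integral_powr_below nn_integral_powr_above)
    also have "- ((r / B) powr (p - 3 + 1)) / (p - 3 + 1) = (r / B) powr (p - 2) / (2 - p)"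
      using p by (simp add: field_simps)
    also have "ennreal (4 * p * B * r) * ennreal ((r / B) powr (p - 2 + 1) / (p - 2 + 1))
        + ennreal (4 * p * r\<^sup>2) * ennreal ((r / B) powr (p - 2) / (2 - p))
      = ennreal (4 * p * B * r * ((r / B) powr (p - 1) / (p - 1))
        + 4 * p * r\<^sup>2 * ((r / B) powr (p - 2) / (2 - p)))"
      using p r \<open>B > 0\<close>
      by (simp add: ennreal_mult'[symmetric] ennreal_plus[symmetric] del: ennreal_plus)
    also have "4 * p * B * r * ((r / B) powr (p - 1) / (p - 1))
        + 4 * p * r\<^sup>2 * ((r / B) powr (p - 2) / (2 - p)) = K * r powr p"
    proof -
      have "B * r * (r / B) powr (p - 1) = B powr (2 - p) * r powr p"
        using r \<open>B > 0\<close> by (simp add: powr_divide powr_diff power2_eq_square field_simps)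
      moreover have "r\<^sup>2 * (r / B) powr (p - 2) = B powr (2 - p) * r powr p"
        using r \<open>B > 0\<close> by (simp add: powr_divide powr_diff power2_eq_square field_simps)
      moreover have "4 * p * B * r * ((r / B) powr (p - 1) / (p - 1))
          + 4 * p * r\<^sup>2 * ((r / B) powr (p - 2) / (2 - p))
        = 4 * p / (p - 1) * (B * r * (r / B) powr (p - 1))
          + 4 * p / (2 - p) * (r\<^sup>2 * (r / B) powr (p - 2))"
        by simp
      ultimately show ?thesis unfolding K_def by (simp only: distrib_right mult.assoc)
    qed
    finally show ?thesis by (simp add: r_def)
  next
    case True
    then have "G s x = 0" for s by (auto simp: G_def)
    then show ?thesis using True by simp
  qed
  interpret pair_sigma_finite Q lborel
    by (intro pair_sigma_finite.intro sigma_finite_measure_axioms sigma_finite_lborel)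
  have "ennreal (\<Sum>j\<in>J. \<nu> j * T j powr p) = (\<Sum>j\<in>J. ennreal (\<nu> j * T j powr p))"
    by (intro sum_ennreal[symmetric]) (simp add: \<nu>_def)
  also have "\<dots> = (\<integral>\<^sup>+s. (\<Sum>j\<in>J. ennreal (p * \<nu> j * (s powr (p - 1) * indicator {0..T j} s))) \<partial>lborel)"
    by (subst nn_integral_sum) (auto intro!: sum.cong layer)
  also have "\<dots> \<le> (\<integral>\<^sup>+s. (\<integral>\<^sup>+x. ennreal (G s x) \<partial>Q) \<partial>lborel)"
    by (intro nn_integral_mono level)
  also have "\<dots> = (\<integral>\<^sup>+x. (\<integral>\<^sup>+s. ennreal (G s x) \<partial>lborel) \<partial>Q)"
    by (rule Fubini') (unfold G_def, measurable)
  also have "\<dots> = ennreal (LINT x|Q. K * norm (f x) powr p)"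
    unfolding inner using fp p by (intro nn_integral_eq_integral) (auto simp: K_def)
  finally have "(\<Sum>j\<in>J. \<nu> j * T j powr p) \<le> (LINT x|Q. K * norm (f x) powr p)"
    using p by (subst (asm) ennreal_le_iff) (auto simp: K_def)
  then show ?thesis by (simp add: summand K_def cong: sum.cong)
qed

text \<open>
  The second summand blows up as \<open>p\<close> tends to \<open>2\<close>, but at \<open>p = 2\<close> itself division by zero makes it
  vanish, leaving the constant \<open>8\<close>; so one formula serves the whole range \<open>1 < p \<le> 2\<close>.
\<close>

definition (in -) paley_const :: "real \<Rightarrow> real" where
  "paley_const p = 4 * p / (p - 1) + 4 * p / (2 - p)"

lemma (in -) paley_const_pos: "1 < p \<Longrightarrow> p \<le> 2 \<Longrightarrow> paley_const p > 0"
  unfolding paley_const_def by (cases "p = 2") (auto intro!: add_pos_pos)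

text \<open>
  At \<open>p = 2\<close> this is Bessel's inequality.
\<close>

lemma paley_finite:
  assumes f [measurable]: "f \<in> borel_measurable Q"
    and fp: "integrable Q (\<lambda>x. norm (f x) powr p)" and p: "1 < p" "p \<le> 2"
    and J: "finite J" and \<phi>: "\<And>j. j \<in> J \<Longrightarrow> \<phi> j > 0"
    and B: "\<And>t. t > 0 \<Longrightarrow> t * (\<Sum>j\<in>{j\<in>J. t \<le> \<phi> j}. (m j)\<^sup>2) \<le> B" and "B > 0"
  shows "(\<Sum>j\<in>J. (norm (coeff f j) / m j) powr p * \<phi> j powr (2 - p) * (m j)\<^sup>2)
    \<le> paley_const p * B powr (2 - p) * (LINT x|Q. norm (f x) powr p)"
proof (cases "p = 2")
  case True
  have f2: "integrable Q (\<lambda>x. (norm (f x))\<^sup>2)" using fp True by simp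
  have "(\<Sum>j\<in>J. (norm (coeff f j) / m j) powr p * \<phi> j powr (2 - p) * (m j)\<^sup>2)
      = (\<Sum>j\<in>J. (norm (coeff f j))\<^sup>2)"
  proof (rule sum.cong)
    fix j assume "j \<in> J"
    then show "(norm (coeff f j) / m j) powr p * \<phi> j powr (2 - p) * (m j)\<^sup>2 = (norm (coeff f j))\<^sup>2"
      using \<phi>[of j] m_pos[of j] True by (simp add: power_divide)
  qed simp
  also have "\<dots> \<le> (LINT x|Q. (norm (f x))\<^sup>2)" by (rule bessel[OF f f2 J])
  also have "\<dots> \<le> 8 * (LINT x|Q. (norm (f x))\<^sup>2)" by simp
  finally show ?thesis using True \<open>B > 0\<close> by (simp add: paley_const_def)
next
  case False
  then show ?thesis
    unfolding paley_const_def using p by (intro paley_below_two[OF f fp _ _ J \<phi> B \<open>B > 0\<close>]) auto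
qed


section \<open>The Hausdorff--Young inequality and interpolation\<close>

text \<open>
  Paley's inequality for the weight \<open>X j powr q\<close>, whose weight constant is at most the left-hand
  side \<open>S\<close>; the exponents match because \<open>p + q * (2 - p) = q\<close> for the conjugate exponent \<open>q\<close>. Indices
  with \<open>X j = 0\<close> are dropped first, since a weight has to be positive.
\<close>

lemma hausdorff_young_finite:
  assumes f: "f \<in> borel_measurable Q"
    and fp: "integrable Q (\<lambda>x. norm (f x) powr p)" and p: "1 < p" "p \<le> 2"
    and J: "finite J"
  shows "(\<Sum>j\<in>J. (norm (coeff f j) / m j) powr (p / (p - 1)) * (m j)\<^sup>2)
    \<le> (paley_const p * (LINT x|Q. norm (f x) powr p)) powr (1 / (p - 1))"
proof -
  define q where "q = p / (p - 1)"
  have q: "p + q * (2 - p) = q" using p by (simp add: q_def field_simps)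
  define X where "X j = norm (coeff f j) / m j" for j
  define J' where "J' = {j\<in>J. X j > 0}"
  have J': "finite J'" using J by (simp add: J'_def)
  define S where "S = (\<Sum>j\<in>J'. X j powr q * (m j)\<^sup>2)"
  define I where "I = (LINT x|Q. norm (f x) powr p)"
  have "X j \<ge> 0" for j unfolding X_def using m_pos[of j] by simp
  then have S: "(\<Sum>j\<in>J. X j powr q * (m j)\<^sup>2) = S"
    unfolding S_def J'_def using J by (intro sum.mono_neutral_right) (auto simp: order.order_iff_strict)
  have "S \<le> (paley_const p * I) powr (1 / (p - 1))"
  proof (cases "J' = {}")
    case True
    then show ?thesis by (simp add: S_def)
  next
    case False
    then have "S > 0"
      unfolding S_def using J' m_pos by (intro sum_pos mult_pos_pos zero_less_power) (auto simp: J'_def)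
    have "t * (\<Sum>j\<in>{j\<in>J'. t \<le> X j powr q}. (m j)\<^sup>2) \<le> S" if "t > 0" for t
    proof -
      have "t * (\<Sum>j\<in>{j\<in>J'. t \<le> X j powr q}. (m j)\<^sup>2)
          \<le> (\<Sum>j\<in>{j\<in>J'. t \<le> X j powr q}. X j powr q * (m j)\<^sup>2)"
        unfolding sum_distrib_left by (intro sum_mono mult_right_mono) auto
      also have "\<dots> \<le> S"
        unfolding S_def using J' by (intro sum_mono2) auto
      finally show ?thesis .
    qed
    then have "(\<Sum>j\<in>J'. X j powr p * (X j powr q) powr (2 - p) * (m j)\<^sup>2)
        \<le> paley_const p * S powr (2 - p) * I"
      unfolding X_def I_def
      by (intro paley_finite[OF f fp p J' _ _ \<open>S > 0\<close>]) (auto simp: J'_def X_def)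
    also have "(\<Sum>j\<in>J'. X j powr p * (X j powr q) powr (2 - p) * (m j)\<^sup>2) = S"
      unfolding S_def by (simp add: powr_powr powr_add[symmetric] q)
    finally have "S powr (p - 2) * S \<le> S powr (p - 2) * (paley_const p * S powr (2 - p) * I)"
      by (intro mult_left_mono) auto
    also have "\<dots> = paley_const p * I"
      using \<open>S > 0\<close> by (simp add: powr_add[symmetric] mult_ac)
    also have "S powr (p - 2) * S = S powr (p - 1)"
      using \<open>S > 0\<close> powr_add[of S "p - 2" 1] by simp
    finally have "(S powr (p - 1)) powr (1 / (p - 1)) \<le> (paley_const p * I) powr (1 / (p - 1))"
      using p by (intro powr_mono2) auto
    then show ?thesis using \<open>S > 0\<close> p by (simp add: powr_powr)
  qed
  then show ?thesis unfolding S[symmetric] X_def q_def I_def .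
qed

text \<open>
  With \<open>b = p * (1 - s) + q * s\<close> the summand is the geometric mean, with exponents \<open>1 - s\<close> and \<open>s\<close>,
  of the summands of Paley's and of the Hausdorff--Young inequality, so Hoelder's inequality combines
  the two. The case \<open>b = p\<close> is Paley's inequality itself; it also absorbs \<open>p = 2\<close>, where \<open>p\<close> and
  \<open>q\<close> coincide and \<open>s\<close> is undetermined.
\<close>

lemma hausdorff_young_paley_finite:
  assumes f: "f \<in> borel_measurable Q"
    and fp: "integrable Q (\<lambda>x. norm (f x) powr p)" and p: "1 < p" "p \<le> 2"
    and q: "q = p / (p - 1)" and b: "p \<le> b" "b \<le> q"
    and J: "finite J" and \<phi>: "\<And>j. j \<in> J \<Longrightarrow> \<phi> j > 0"
    and B: "\<And>t. t > 0 \<Longrightarrow> t * (\<Sum>j\<in>{j\<in>J. t \<le> \<phi> j}. (m j)\<^sup>2) \<le> B" and "B > 0"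
  shows "(\<Sum>j\<in>J. (norm (coeff f j) / m j) powr b * \<phi> j powr (1 - b / q) * (m j)\<^sup>2)
    \<le> (paley_const p * (LINT x|Q. norm (f x) powr p)) powr (b / p) * B powr (1 - b / q)"
proof -
  define X where "X j = norm (coeff f j) / m j" for j
  define D where "D = paley_const p * (LINT x|Q. norm (f x) powr p)"
  have "D \<ge> 0" unfolding D_def using paley_const_pos[OF p] by simp
  have X: "X j \<ge> 0" for j unfolding X_def using m_pos[of j] by simp
  have paley: "(\<Sum>j\<in>J. X j powr p * \<phi> j powr (2 - p) * (m j)\<^sup>2) \<le> D * B powr (2 - p)"
    using paley_finite[OF f fp p J \<phi> B \<open>B > 0\<close>] by (simp add: X_def D_def mult_ac)
  have hy: "(\<Sum>j\<in>J. X j powr q * (m j)\<^sup>2) \<le> D powr (1 / (p - 1))"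
    using hausdorff_young_finite[OF f fp p J] by (simp add: X_def D_def q)
  have "(\<Sum>j\<in>J. X j powr b * \<phi> j powr (1 - b / q) * (m j)\<^sup>2) \<le> D powr (b / p) * B powr (1 - b / q)"
  proof (cases "b = p")
    case True
    have e: "1 - b / q = 2 - p" using p by (simp add: True q field_simps)
    show ?thesis unfolding e using paley \<open>D \<ge> 0\<close> p True by simp
  next
    case False
    with b have "p < b" "p < q" by auto
    then have "p \<noteq> 2" using p by (auto simp: q)
    with p have "p < 2" by simp
    define s where "s = (b - p) / (q - p)"
    have s: "0 \<le> s" "s \<le> 1" using b \<open>p < q\<close> by (auto simp: s_def)
    have sb: "p * (1 - s) + q * s = b"
    proof -
      have "s * (q - p) = b - p" using \<open>p < q\<close> by (simp add: s_def)
      then show ?thesis by (simp add: algebra_simps)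
    qed
    have pq: "p / q = p - 1" "q / p = 1 / (p - 1)" "q \<noteq> 0" using p by (auto simp: q)
    have s2: "(2 - p) * (1 - s) = 1 - b / q"
    proof -
      have "b / q = p / q * (1 - s) + s" using pq(3) by (simp add: sb[symmetric] add_divide_distrib)
      then show ?thesis unfolding pq(1) by (simp add: algebra_simps)
    qed
    have s3: "(1 - s) + 1 / (p - 1) * s = b / p"
      unfolding pq(2)[symmetric] using p by (simp add: sb[symmetric] add_divide_distrib)
    have "(\<Sum>j\<in>J. X j powr b * \<phi> j powr (1 - b / q) * (m j)\<^sup>2)
        = (\<Sum>j\<in>J. (X j powr p * \<phi> j powr (2 - p) * (m j)\<^sup>2) powr (1 - s) * (X j powr q * (m j)\<^sup>2) powr s)"
    proof (rule sum.cong)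
      fix j assume "j \<in> J"
      have "(X j powr p * \<phi> j powr (2 - p) * (m j)\<^sup>2) powr (1 - s) * (X j powr q * (m j)\<^sup>2) powr s
          = (X j powr (p * (1 - s)) * X j powr (q * s)) * \<phi> j powr ((2 - p) * (1 - s))
            * (((m j)\<^sup>2) powr (1 - s) * ((m j)\<^sup>2) powr s)"
        by (simp add: powr_mult powr_powr mult_ac)
      also have "\<dots> = X j powr b * \<phi> j powr (1 - b / q) * (m j)\<^sup>2"
        unfolding powr_add[symmetric] sb s2 by simp
      finally show "X j powr b * \<phi> j powr (1 - b / q) * (m j)\<^sup>2 =
         (X j powr p * \<phi> j powr (2 - p) * (m j)\<^sup>2) powr (1 - s) * (X j powr q * (m j)\<^sup>2) powr s" by simp
    qed simp
    also have "\<dots> \<le> (D * B powr (2 - p)) powr (1 - s) * (D powr (1 / (p - 1))) powr s"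
      by (intro holder_sum_le J paley hy s mult_nonneg_nonneg) auto
    also have "\<dots> = D powr ((1 - s) + 1 / (p - 1) * s) * B powr ((2 - p) * (1 - s))"
      using \<open>D \<ge> 0\<close> \<open>B > 0\<close> by (simp add: powr_mult powr_powr powr_add mult_ac)
    finally show ?thesis unfolding s2 s3 .
  qed
  then show ?thesis by (simp add: X_def D_def)
qed

end


section \<open>Transfer to the Fourier transform of an orthonormal basis\<close>

lemma sigma_finite_lebesgue: "sigma_finite_measure (lebesgue :: 'a::euclidean_space measure)"
proof
  obtain A :: "'a set set" where "countable A" "A \<subseteq> sets lborel" "\<Union>A = space lborel"
    "\<forall>a\<in>A. emeasure lborel a \<noteq> \<infinity>"
    using lborel.sigma_finite_countable by blast
  then show "\<exists>A::'a set set. countable A \<and> A \<subseteq> sets lebesgue \<and> \<Union>A = space lebesgue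
      \<and> (\<forall>a\<in>A. emeasure lebesgue a \<noteq> \<infinity>)"
    by (intro exI[of _ A]) (force intro: sets_completionI_sets simp: emeasure_completion)
qed

lemma Linf_norm_pos:
  assumes "orthonormal_basis u"
  shows "Linf_norm (u j) > 0"
proof (rule ccontr)
  assume "\<not> Linf_norm (u j) > 0"
  then have "Linf_norm (u j) = 0" by simp
  then have "AE x in lebesgue. ennreal (norm (u j x)) \<le> 0"
    using esssup_AE[of "\<lambda>x. ennreal (norm (u j x))" lebesgue] by (simp add: Linf_norm_def)
  then have "AE x in lebesgue. u j x * cnj (u j x) = 0" by eventually_elim simp
  then have "L2_inner (u j) (u j) = 0" unfolding L2_inner_def by (rule integral_eq_zero_AE)
  moreover have "L2_inner (u j) (u j) = 1" using assms by (simp add: orthonormal_basis_def)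
  ultimately show False by simp
qed

lemma sum_Linf_le_M_bound:
  assumes "t > 0" "finite J" "\<And>j. j \<in> J \<Longrightarrow> t \<le> \<phi> j"
  shows "ennreal t * (\<Sum>j\<in>J. (Linf_norm (u j))\<^sup>2) \<le> M_bound u \<phi>"
proof -
  have "(\<Sum>j\<in>J. (Linf_norm (u j))\<^sup>2) \<le> (\<Sum>\<^sub>\<infinity>j\<in>{j. t \<le> \<phi> j}. (Linf_norm (u j))\<^sup>2)"
    using assms by (subst nonneg_infsum_complete) (auto intro: SUP_upper)
  then have "ennreal t * (\<Sum>j\<in>J. (Linf_norm (u j))\<^sup>2)
      \<le> ennreal t * (\<Sum>\<^sub>\<infinity>j\<in>{j. t \<le> \<phi> j}. (Linf_norm (u j))\<^sup>2)"
    by (rule mult_left_mono) simp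
  also have "\<dots> \<le> M_bound u \<phi>" unfolding M_bound_def using \<open>t > 0\<close> by (intro SUP_upper) auto
  finally show ?thesis .
qed

text \<open>
  The index \<open>j\<close> itself contributes to the supremum defining \<open>M_bound u \<phi>\<close> at the height \<open>t = \<phi> j\<close>.
\<close>

lemma Linf_norm_finite:
  assumes "M_bound u \<phi> < \<infinity>" "\<phi> j > 0"
  shows "Linf_norm (u j) < \<infinity>"
proof (rule ccontr)
  assume "\<not> Linf_norm (u j) < \<infinity>"
  then have "Linf_norm (u j) = top" by (metis infinity_ennreal_def top.not_eq_extremum)
  then have "ennreal (\<phi> j) * (\<Sum>j\<in>{j}. (Linf_norm (u j))\<^sup>2) = top"
    using assms(2) by (simp add: ennreal_mult_eq_top_iff power2_eq_square)
  then show False using sum_Linf_le_M_bound[of "\<phi> j" "{j}" \<phi> u] assms by (simp add: top_unique)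
qed

theorem theorem1p1:
  fixes k l :: nat
    and T :: "(real ^ 'n::finite) operator"
    and u :: "nat \<Rightarrow> real ^ 'n \<Rightarrow> complex"
    and ev :: "nat \<Rightarrow> real"
    and p p' :: real
  assumes "k \<ge> 1" and "l \<ge> 1"
    and "is_anharmonic_oscillator k l T"
    and "orthonormal_basis u"
    and "\<And>j. eigenfunction T (ev j) (u j)"
    and "incseq ev"
    and "1 < p" and "p \<le> 2"
    and "p' = p / (p - 1)"
  shows "\<exists>C>0. \<forall>(b::real) (\<phi> :: nat \<Rightarrow> real) (f :: real ^ 'n \<Rightarrow> complex).
      p \<le> b \<longrightarrow> b \<le> p' \<longrightarrow> (\<forall>j. \<phi> j > 0) \<longrightarrow> M_bound u \<phi> < \<infinity> \<longrightarrow> f \<in> Lp_space p \<longrightarrow>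
      (let a = (\<lambda>j. (norm (fourier_coeff u f j) * \<phi> j powr (1 / b - 1 / p')) powr b
                      * enn2real (Linf_norm (u j)) powr (2 - b))
       in summable a \<and>
          (\<Sum>j. a j) powr (1 / b)
            \<le> C * enn2real (M_bound u \<phi>) powr (1 / b - 1 / p') * Lp_norm p f)"
proof (intro exI[of _ "paley_const p powr (1 / p)"] conjI allI impI)
  note u = \<open>orthonormal_basis u\<close> and p = \<open>1 < p\<close> \<open>p \<le> 2\<close>
  have K: "paley_const p > 0" using paley_const_pos[OF p] .
  then show "paley_const p powr (1 / p) > 0" by simp
  fix b :: real and \<phi> :: "nat \<Rightarrow> real" and f :: "real ^ 'n \<Rightarrow> complex"
  assume b: "p \<le> b" "b \<le> p'" and \<phi>: "\<forall>j. \<phi> j > 0" and fin: "M_bound u \<phi> < \<infinity>" and f: "f \<in> Lp_space p"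
  define m where "m j = enn2real (Linf_norm (u j))" for j
  have Linf: "Linf_norm (u j) = ennreal (m j)" for j
    using Linf_norm_finite[OF fin, of j] \<phi> by (simp add: m_def)
  have m_pos: "m j > 0" for j
    using Linf_norm_pos[OF u, of j] by (simp add: Linf)
  define B where "B = enn2real (M_bound u \<phi>)"
  have B: "t * (\<Sum>j\<in>J. (m j)\<^sup>2) \<le> B" if "t > 0" "finite J" "\<And>j. j \<in> J \<Longrightarrow> t \<le> \<phi> j" for t J
  proof -
    have "ennreal t * (\<Sum>j\<in>J. (Linf_norm (u j))\<^sup>2) = ennreal (t * (\<Sum>j\<in>J. (m j)\<^sup>2))"
      using m_pos \<open>t > 0\<close>
      by (simp add: Linf ennreal_power less_imp_le ennreal_mult'' sum_nonneg)
    moreover have "M_bound u \<phi> = ennreal B" using fin by (simp add: B_def)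
    ultimately have "ennreal (t * (\<Sum>j\<in>J. (m j)\<^sup>2)) \<le> ennreal B"
      using sum_Linf_le_M_bound[of t J \<phi> u] that by simp
    then show ?thesis by (rule ennreal_le_iff[THEN iffD1, rotated]) (simp add: B_def)
  qed
  have "\<phi> 0 * (\<Sum>j\<in>{0}. (m j)\<^sup>2) \<le> B" using \<phi> by (intro B) auto
  moreover have "\<phi> 0 * (m 0)\<^sup>2 > 0" using \<phi> m_pos[of 0] by simp
  ultimately have "B > 0" by simp
  interpret bounded_orthonormal_system lebesgue u m
  proof (intro bounded_orthonormal_system.intro bounded_orthonormal_system_axioms.intro
      sigma_finite_lebesgue m_pos)
    fix j
    show "AE x in lebesgue. norm (u j x) \<le> m j"
      using esssup_AE[of "\<lambda>x. ennreal (norm (u j x))" lebesgue] m_pos[of j]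
      by (simp add: Linf_norm_def[symmetric] Linf)
  qed (use u in \<open>auto simp: orthonormal_basis_def Lp_space_def L2_inner_def\<close>)
  have coeff: "fourier_coeff u f = coeff f" by (simp add: fun_eq_iff fourier_coeff_def coeff_def)
  define a where "a j = (norm (fourier_coeff u f j) * \<phi> j powr (1 / b - 1 / p')) powr b
      * enn2real (Linf_norm (u j)) powr (2 - b)" for j
  have a: "a j = (norm (coeff f j) / m j) powr b * \<phi> j powr (1 - b / p') * (m j)\<^sup>2" for j
  proof -
    have "(1 / b - 1 / p') * b = 1 - b / p'" using p b by (simp add: field_simps)
    moreover have "m j powr (2 - b) = (m j)\<^sup>2 / m j powr b" using m_pos[of j] by (simp add: powr_diff)
    ultimately show ?thesis
      using m_pos[of j] unfolding a_def coeff m_def[symmetric]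
      by (simp add: powr_mult powr_powr powr_divide)
  qed
  have a_nonneg: "a j \<ge> 0" for j by (simp add: a_def)
  define I where "I = (LINT x|lebesgue. norm (f x) powr p)"
  define R where "R = (paley_const p * I) powr (b / p) * B powr (1 - b / p')"
  have bound: "(\<Sum>j\<in>J. a j) \<le> R" if "finite J" for J
    unfolding a R_def I_def using f \<phi> that
    by (intro hausdorff_young_paley_finite p b assms \<open>B > 0\<close> B) (auto simp: Lp_space_def)
  have "summable a"
    by (rule summableI_nonneg_bounded[OF a_nonneg, of _ R]) (simp add: bound)
  moreover have "(\<Sum>j. a j) powr (1 / b) \<le> paley_const p powr (1 / p) * B powr (1 / b - 1 / p') * Lp_norm p f"
  proof -
    have "(\<Sum>j. a j) \<le> R" using \<open>summable a\<close> by (intro suminf_le_const bound) auto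
    then have "(\<Sum>j. a j) powr (1 / b) \<le> R powr (1 / b)"
      using a_nonneg \<open>summable a\<close> p b by (intro powr_mono2 suminf_nonneg) auto
    also have "\<dots> = (paley_const p * I) powr (b / p * (1 / b)) * B powr ((1 - b / p') * (1 / b))"
      by (simp add: R_def powr_mult powr_powr)
    also have "b / p * (1 / b) = 1 / p" using p b by simp
    also have "(1 - b / p') * (1 / b) = 1 / b - 1 / p'" using p b by (simp add: field_simps)
    also have "(paley_const p * I) powr (1 / p) = paley_const p powr (1 / p) * Lp_norm p f"
      using K by (simp add: powr_mult Lp_norm_def I_def)
    finally show ?thesis by (simp add: mult_ac)
  qed
  ultimately show "let a = (\<lambda>j. (norm (fourier_coeff u f j) * \<phi> j powr (1 / b - 1 / p')) powr b
                      * enn2real (Linf_norm (u j)) powr (2 - b))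
       in summable a \<and>
          (\<Sum>j. a j) powr (1 / b)
            \<le> paley_const p powr (1 / p) * enn2real (M_bound u \<phi>) powr (1 / b - 1 / p') * Lp_norm p f"
    unfolding Let_def B_def a_def by (rule conjI)
qed

end
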